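(* Let $f:\mathbb{R}^n\to\mathbb{R}^n$ be a nonconstant polynomial map with $f(0)=0$ and with leading term $f^\infty$. Suppose there is a vector $d>0$ in $\mathbb{R}^n$ such that one of the following conditions holds: (a) $\mathrm{SOL}(f^\infty,0)=\{0\}=\mathrm{SOL}(f^\infty,d)$; (b) $\mathrm{SOL}(f^\infty,0)=\{0\}=\mathrm{SOL}(f,d)$. Then $\deg(\widehat{f^\infty},0)=1$, where $\widehat{f^\infty}(x):=\min\{x,f^\infty(x)\}$. Hence, for all $q\in\mathbb{R}^n$, $\mathrm{PCP}(f,q)$ has a nonempty compact solution set.
   Context: For $x,y\in\mathbb{R}^n$, $\min\{x,y\}$ is the componentwise minimum; $x\ge 0$ (resp. $x>0$) means all components are nonnegative (resp. positive). For a polynomial map $f:\mathbb{R}^n\to\mathbb{R}^n$ and $q\in\mathbb{R}^n$, $\mathrm{PCP}(f,q)$ is the problem of finding $x$ with $x\ge 0$, $f(x)+q\ge 0$, $\langle x,f(x)+q\rangle=0$; $\mathrm{SOL}(f,q)$ denotes its solution set. Leading term: write $f$ as a sum of homogeneous polynomial maps, $f=f_{m-1}+f_{m-2}+\cdots+f_0$, where $f_j$ is homogeneous of degree $j$ and $f_{m-1}\neq 0$ ($m\ge 2$ since $f$ is nonconstant). Then $f^\infty(x):=\lim_{\lambda\to\infty} f(\lambda x)/\lambda^{m-1}=f_{m-1}(x)$. Local degree: if $h:\mathbb{R}^n\to\mathbb{R}^n$ is continuous and $h(x)=0\Leftrightarrow x=0$, then $\deg(h,0)$ denotes the Brouwer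 degree $\deg(h,\Omega,0)$ of $h$ over any bounded open set $\Omega$ containing $0$ with respect to the value $0$. The condition $\mathrm{SOL}(f^\infty,0)=\{0\}$ says exactly that $\widehat{f^\infty}(x)=0\Leftrightarrow x=0$, so $\deg(\widehat{f^\infty},0)$ is defined. *)

theory Defs
  imports "HOL-Analysis.Analysis" "HOL-Homology.Homology"
begin

definition homogeneous_polynomial_map ::
    "nat \<Rightarrow> ('a::euclidean_space \<Rightarrow> 'b::euclidean_space) \<Rightarrow> bool" where
  "homogeneous_polynomial_map j g \<longleftrightarrow>
     polynomial_function g \<and> (\<forall>c x. g (c *\<^sub>R x) = c ^ j *\<^sub>R g x)"

text \<open>
  The index \<open>m - 1\<close> of the top component in \<open>f = f\<^sub>m\<^sub>-\<^sub>1 + \<dots> + f\<^sub>0\<close>, where every \<open>f\<^sub>j\<close> is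
  homogeneous of degree \<open>j\<close> and \<open>f\<^sub>m\<^sub>-\<^sub>1 \<noteq> 0\<close>. It is uniquely determined for every polynomial
  map that is not identically zero.
\<close>

definition polynomial_map_degree ::
    "('a::euclidean_space \<Rightarrow> 'b::euclidean_space) \<Rightarrow> nat" where
  "polynomial_map_degree f =
     (THE N. \<exists>F. (\<forall>j\<le>N. homogeneous_polynomial_map j (F j)) \<and>
                 (\<forall>x. f x = (\<Sum>j\<le>N. F j x)) \<and> (\<exists>x. F N x \<noteq> 0))"

definition leading_term ::
    "('a::euclidean_space \<Rightarrow> 'b::euclidean_space) \<Rightarrow> 'a \<Rightarrow> 'b" where
  "leading_term f x = Lim at_top (\<lambda>t::real. f (t *\<^sub>R x) /\<^sub>R t ^ polynomial_map_degree f)"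

text \<open>The solution set of the polynomial complementarity problem \<open>PCP(f, q)\<close>.\<close>

definition SOL :: "(real^'n \<Rightarrow> real^'n) \<Rightarrow> real^'n \<Rightarrow> (real^'n) set" where
  "SOL f q = {x. (\<forall>i. 0 \<le> x $ i) \<and> (\<forall>i. 0 \<le> (f x + q) $ i) \<and> x \<bullet> (f x + q) = 0}"

definition min_map :: "(real^'n \<Rightarrow> real^'n) \<Rightarrow> real^'n \<Rightarrow> real^'n" where
  "min_map g x = (\<chi> i. min (x $ i) (g x $ i))"

text \<open>
  The Brouwer degree \<open>deg(h, \<Omega>, p)\<close> for \<open>\<Omega>\<close> open and bounded, \<open>h\<close> continuous on the closure
  of \<open>\<Omega>\<close>, and \<open>p \<notin> h(\<partial>\<Omega>)\<close>, as it is defined by singular homology (Dold, Lectures on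
  Algebraic Topology, Chapter VIII.4). Write \<open>E\<close> for the Euclidean space of dimension \<open>n\<close>
  and \<open>K = {x \<in> \<Omega>. h x = p}\<close>, a compact set. The degree is the integer \<open>k\<close> such that

    \<open>h\<^sub>* : H\<^sub>n(\<Omega>, \<Omega> - K) \<rightarrow> H\<^sub>n(E, E - {p})\<close>

  sends the fundamental class around \<open>K\<close> to \<open>k\<close> times the fundamental class around \<open>p\<close>.
  For a ball \<open>B\<close> containing \<open>\<Omega>\<close> and \<open>p\<close>, every element \<open>o\<close> of \<open>H\<^sub>n(E, E - B)\<close>, which is
  infinite cyclic, induces both classes (up to one common factor): its image in
  \<open>H\<^sub>n(E, E - K)\<close> comes by excision from a unique \<open>c\<close> in \<open>H\<^sub>n(\<Omega>, \<Omega> - K)\<close>, and its image in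
  \<open>H\<^sub>n(E, E - {p})\<close> is the class around \<open>p\<close>. The homology groups of the library are written
  multiplicatively, so \<open>k\<close> times a class is a \<open>k\<close>-th power.
\<close>

definition brouwer_degree ::
    "('a::euclidean_space \<Rightarrow> 'a) \<Rightarrow> 'a set \<Rightarrow> 'a \<Rightarrow> int" where
  "brouwer_degree h \<Omega> p =
     (let n = int DIM('a); K = {x \<in> \<Omega>. h x = p}; Hp = relative_homology_group n euclidean (- {p})
      in THE k::int. \<forall>r. \<Omega> \<union> {p} \<subseteq> ball 0 r \<longrightarrow>
           (\<forall>o\<^sub>B \<in> carrier (relative_homology_group n euclidean (- ball 0 r)).
            \<forall>c \<in> carrier (relative_homology_group n (top_of_set \<Omega>) (\<Omega> - K)).
              hom_induced n (top_of_set \<Omega>) (\<Omega> - K) euclidean (- K) id c =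
              hom_induced n euclidean (- ball 0 r) euclidean (- K) id o\<^sub>B \<longrightarrow>
              hom_induced n (top_of_set \<Omega>) (\<Omega> - K) euclidean (- {p}) h c =
              hom_induced n euclidean (- ball 0 r) euclidean (- {p}) id o\<^sub>B [^]\<^bsub>Hp\<^esub> k))"

end

theory Submission
  imports Defs
begin

text \<open>
  Write \<open>f = F\<^sub>N + \<dots> + F\<^sub>0\<close> with \<open>F\<^sub>j\<close> homogeneous of degree \<open>j\<close>, and for \<open>t > 0\<close> let
  \<open>f\<^sub>t x = t\<^sup>N f (x / t)\<close>, which extends continuously to \<open>f\<^sub>0 = F\<^sub>N\<close>. Condition (b) says, after
  scaling, that \<open>min {x, f\<^sub>t x + t\<^sup>N d}\<close> vanishes only at \<open>x = 0\<close>, for every \<open>t\<close> in \<open>[0, 1]\<close>; condition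
  (a) is condition (b) for the map \<open>F\<^sub>N\<close>. At \<open>t = 1\<close> this map is the identity near \<open>0\<close>, because
  \<open>d > 0 = f 0\<close>. Rescaling turns it into the identity on any bounded set, so \<open>min {x, F\<^sub>N x}\<close> is
  homotopic to the identity without further zeros and has degree \<open>1\<close>.

  For arbitrary \<open>q\<close> and small \<open>\<tau> > 0\<close>, the maps \<open>min {x, f\<^sub>t x + t\<^sup>N q}\<close> with \<open>t \<le> \<tau>\<close> have no zero on
  the unit sphere, which bounds \<open>SOL f q\<close>. If \<open>SOL f q\<close> were empty, the map for \<open>t = \<tau>\<close> would
  extend over the ball without zeros, and the identity of the sphere would be null-homotopic in
  the punctured space.
\<close>

section \<open>Homogeneous components of polynomial maps\<close>

text \<open>Along the line through \<open>x\<close>, \<open>p\<close> is a univariate polynomial in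
  \<open>t\<close>; its coefficients, as functions of \<open>x\<close>, will serve as homogeneous
  components. The bound \<open>N\<close> is uniform in \<open>x\<close>, so finitely many components
  suffice for all points.\<close>

lemma real_polynomial_function_along_rays:
  fixes p :: "'a::real_normed_vector \<Rightarrow> real"
  assumes "real_polynomial_function p"
  shows "\<exists>P N. (\<forall>x t. p (t *\<^sub>R x) = poly (P x) t) \<and>
               (\<forall>j. real_polynomial_function (\<lambda>x. poly.coeff (P x) j)) \<and> (\<forall>x. Polynomial.degree (P x) \<le> N)"
  using assms
proof induction
  case (linear f)
  interpret bounded_linear f by fact
  have "real_polynomial_function (\<lambda>x. poly.coeff [:0, f x:] j)" for j
  proof (cases "j = Suc 0")
    case True
    then show ?thesis using real_polynomial_function.intros(1)[OF \<open>bounded_linear f\<close>] by simp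
  next
    case False
    then have "(\<lambda>x. poly.coeff [:0, f x:] j) = (\<lambda>x. 0)"
      by (auto simp: coeff_pCons split: nat.split)
    then show ?thesis by (simp add: real_polynomial_function.intros(2))
  qed
  then show ?case
    by (intro exI[of _ "\<lambda>x. [:0, f x:]"] exI[of _ 1]) (auto simp: scaleR)
next
  case (const c)
  show ?case
    by (intro exI[of _ "\<lambda>x. [:c:]"] exI[of _ 0]) auto
next
  case (add f g)
  then obtain P N Q M where PQ:
    "\<forall>x t. f (t *\<^sub>R x) = poly (P x) t" "\<forall>j. real_polynomial_function (\<lambda>x. poly.coeff (P x) j)"
    "\<forall>x. Polynomial.degree (P x) \<le> N"
    "\<forall>x t. g (t *\<^sub>R x) = poly (Q x) t" "\<forall>j. real_polynomial_function (\<lambda>x. poly.coeff (Q x) j)"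
    "\<forall>x. Polynomial.degree (Q x) \<le> M"
    by blast
  have "Polynomial.degree (P x + Q x) \<le> max N M" for x
    using PQ(3,6) by (intro order_trans[OF Polynomial.degree_add_le_max] max.mono) auto
  with PQ show ?case
    by (intro exI[of _ "\<lambda>x. P x + Q x"] exI[of _ "max N M"]) auto
next
  case (mult f g)
  then obtain P N Q M where PQ:
    "\<forall>x t. f (t *\<^sub>R x) = poly (P x) t" "\<forall>j. real_polynomial_function (\<lambda>x. poly.coeff (P x) j)"
    "\<forall>x. Polynomial.degree (P x) \<le> N"
    "\<forall>x t. g (t *\<^sub>R x) = poly (Q x) t" "\<forall>j. real_polynomial_function (\<lambda>x. poly.coeff (Q x) j)"
    "\<forall>x. Polynomial.degree (Q x) \<le> M"
    by blast
  have "real_polynomial_function (\<lambda>x. poly.coeff (P x * Q x) j)" for j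
    unfolding Polynomial.coeff_mult using PQ(2,5)
    by (intro real_polynomial_function_sum real_polynomial_function.intros(4)) auto
  moreover have "Polynomial.degree (P x * Q x) \<le> N + M" for x
    using PQ(3,6) by (intro order_trans[OF Polynomial.degree_mult_le] add_mono) auto
  ultimately show ?case
    using PQ(1,4) by (intro exI[of _ "\<lambda>x. P x * Q x"] exI[of _ "N + M"]) auto
qed

text \<open>The component of degree \<open>j\<close> is the coefficient of \<open>t ^ j\<close> in
  \<open>p (t *\<^sub>R x)\<close>. Vanishing beyond \<open>N\<close> is recorded so that
  decompositions of several coordinates can be padded to one length.\<close>

lemma real_polynomial_function_homogeneous_decomposition:
  fixes p :: "'a::euclidean_space \<Rightarrow> real"
  assumes "real_polynomial_function p"
  shows "\<exists>N F. (\<forall>j. homogeneous_polynomial_map j (F j)) \<and> (\<forall>j>N. \<forall>x. F j x = 0) \<and>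
               (\<forall>x. p x = (\<Sum>j\<le>N. F j x))"
proof -
  obtain P N where P: "\<And>x t. p (t *\<^sub>R x) = poly (P x) t"
    and coeff: "\<And>j. real_polynomial_function (\<lambda>x. poly.coeff (P x) j)" and deg: "\<And>x. Polynomial.degree (P x) \<le> N"
    using real_polynomial_function_along_rays[OF assms] by metis
  have "poly.coeff (P (c *\<^sub>R x)) j = c ^ j * poly.coeff (P x) j" for c x j
  proof -
    \<comment> \<open>Both sides equal \<open>p ((t * c) *\<^sub>R x)\<close>. A real polynomial is
      determined by its values, and comparing coefficients then gives homogeneity.\<close>
    have "poly (P (c *\<^sub>R x)) t = poly (pcompose (P x) [:0, c:]) t" for t
      using P[of t "c *\<^sub>R x"] P[of "t * c" x] by (simp add: poly_pcompose mult.commute)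
    then have "P (c *\<^sub>R x) = pcompose (P x) [:0, c:]"
      by (simp add: poly_eq_poly_eq_iff[symmetric] fun_eq_iff)
    then show ?thesis by (simp add: coeff_pcompose_linear)
  qed
  then have "homogeneous_polynomial_map j (\<lambda>x. poly.coeff (P x) j)" for j
    using coeff by (auto simp: homogeneous_polynomial_map_def real_polynomial_function_eq)
  moreover have "p x = (\<Sum>j\<le>N. poly.coeff (P x) j)" for x
  proof -
    have "p x = (\<Sum>j\<le>Polynomial.degree (P x). poly.coeff (P x) j)"
      using P[of 1 x] by (simp add: poly_altdef)
    also have "\<dots> = (\<Sum>j\<le>N. poly.coeff (P x) j)"
      using deg[of x] by (intro sum.mono_neutral_left) (auto intro: coeff_eq_0)
    finally show ?thesis .
  qed
  moreover have "poly.coeff (P x) j = 0" if "j > N" for j x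
    using that deg[of x] by (simp add: coeff_eq_0)
  ultimately show ?thesis
    by (intro exI[of _ N] exI[of _ "\<lambda>j x. poly.coeff (P x) j"]) auto
qed

lemma homogeneous_polynomial_map_sum_scaleR:
  fixes F :: "'i \<Rightarrow> 'a::euclidean_space \<Rightarrow> real" and v :: "'i \<Rightarrow> 'b::euclidean_space"
  assumes "finite I" "\<And>i. i \<in> I \<Longrightarrow> homogeneous_polynomial_map j (F i)"
  shows "homogeneous_polynomial_map j (\<lambda>x. \<Sum>i\<in>I. F i x *\<^sub>R v i)"
  using assms
  by (auto simp: homogeneous_polynomial_map_def scaleR_sum_right
           intro!: sum.cong polynomial_function_sum polynomial_function_mult)

lemma polynomial_function_homogeneous_decomposition:
  fixes f :: "'a::euclidean_space \<Rightarrow> 'b::euclidean_space"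
  assumes "polynomial_function f"
  shows "\<exists>N F. (\<forall>j. homogeneous_polynomial_map j (F j)) \<and> (\<forall>x. f x = (\<Sum>j\<le>N. F j x))"
proof -
  have "\<forall>b\<in>Basis. \<exists>N F. (\<forall>j. homogeneous_polynomial_map j (F j)) \<and> (\<forall>j>N. \<forall>x. F j x = 0) \<and>
               (\<forall>x. f x \<bullet> b = (\<Sum>j\<le>N. F j x))"
    using assms
    by (intro ballI real_polynomial_function_homogeneous_decomposition) (simp add: polynomial_function_iff_Basis_inner)
  then obtain N F where F: "\<And>b j. b \<in> Basis \<Longrightarrow> homogeneous_polynomial_map j (F b j)"
    and zero: "\<And>b j x. b \<in> Basis \<Longrightarrow> j > N b \<Longrightarrow> F b j x = 0"
    and f: "\<And>b x. b \<in> Basis \<Longrightarrow> f x \<bullet> b = (\<Sum>j\<le>N b. F b j x)"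
    by metis
  \<comment> \<open>The coordinates have decompositions of different lengths; zero components pad
    each of them to the largest.\<close>
  define M where "M = Max (N ` Basis)"
  have "f x = (\<Sum>j\<le>M. \<Sum>b\<in>Basis. F b j x *\<^sub>R b)" for x
  proof -
    have "f x \<bullet> b = (\<Sum>j\<le>M. F b j x)" if "b \<in> Basis" for b
      unfolding f[OF that] using that zero[OF that]
      by (intro sum.mono_neutral_left) (auto simp: M_def not_le intro: Max_ge order_trans)
    then have "f x = (\<Sum>b\<in>Basis. (\<Sum>j\<le>M. F b j x) *\<^sub>R b)"
      by (metis (no_types, lifting) euclidean_representation sum.cong)
    also have "\<dots> = (\<Sum>j\<le>M. \<Sum>b\<in>Basis. F b j x *\<^sub>R b)"
      unfolding scaleR_sum_left by (rule sum.swap)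
    finally show ?thesis .
  qed
  moreover have "homogeneous_polynomial_map j (\<lambda>x. \<Sum>b\<in>Basis. F b j x *\<^sub>R b)" for j
    using F by (intro homogeneous_polynomial_map_sum_scaleR) auto
  ultimately show ?thesis
    by (intro exI[of _ M] exI[of _ "\<lambda>j x. \<Sum>b\<in>Basis. F b j x *\<^sub>R b"]) auto
qed

lemma sum_homogeneous_scaleR:
  assumes "\<And>j. j \<le> N \<Longrightarrow> homogeneous_polynomial_map j (F j)"
  shows "(\<Sum>j\<le>N. F j (t *\<^sub>R x)) = (\<Sum>j\<le>N. t ^ j *\<^sub>R F j x)"
  using assms by (auto simp: homogeneous_polynomial_map_def)

text \<open>The component of degree \<open>j\<close> gets the factor \<open>t ^ j / t ^ M\<close>,
  which tends to 1 for \<open>j = M\<close> and to 0 for \<open>j < M\<close>. The case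
  \<open>N = M\<close> computes the leading term, the case \<open>N < M\<close> shows that the
  degree is unique.\<close>

lemma tendsto_sum_homogeneous:
  fixes F :: "nat \<Rightarrow> 'a::euclidean_space \<Rightarrow> 'b::euclidean_space"
  assumes F: "\<And>j. j \<le> N \<Longrightarrow> homogeneous_polynomial_map j (F j)" and "N \<le> M"
  shows "((\<lambda>t::real. (\<Sum>j\<le>N. F j (t *\<^sub>R x)) /\<^sub>R t ^ M) \<longlongrightarrow> (if N = M then F N x else 0)) at_top"
proof -
  have "((\<lambda>t::real. (\<Sum>j\<le>N. (t ^ j / t ^ M) *\<^sub>R F j x)) \<longlongrightarrow>
         (\<Sum>j\<le>N. (if j = M then 1 else 0) *\<^sub>R F j x)) at_top"
  proof (intro tendsto_sum tendsto_scaleR tendsto_const)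
    fix j assume "j \<in> {..N}"
    show "((\<lambda>t::real. t ^ j / t ^ M) \<longlongrightarrow> (if j = M then 1 else 0)) at_top"
    proof (cases "j = M")
      case True
      have "\<forall>\<^sub>F t::real in at_top. t ^ j / t ^ M = 1"
        using eventually_gt_at_top[of 0] by eventually_elim (simp add: True)
      with True show ?thesis by (simp add: tendsto_eventually)
    next
      case False
      with \<open>j \<in> {..N}\<close> \<open>N \<le> M\<close> have "M - j \<noteq> 0" "M = j + (M - j)" by auto
      have "((\<lambda>t::real. inverse t ^ (M - j)) \<longlongrightarrow> 0 ^ (M - j)) at_top"
        by (intro tendsto_power tendsto_inverse_0_at_top filterlim_ident)
      then have "((\<lambda>t::real. inverse t ^ (M - j)) \<longlongrightarrow> 0) at_top"
        using \<open>M - j \<noteq> 0\<close> by (simp only: power_0_left if_False)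
      moreover have "\<forall>\<^sub>F t::real in at_top. inverse t ^ (M - j) = t ^ j / t ^ M"
        using eventually_gt_at_top[of 0]
      proof eventually_elim
        case (elim t)
        have "t ^ M = t ^ j * t ^ (M - j)"
          using \<open>M = j + (M - j)\<close> by (metis power_add)
        with elim show ?case by (simp add: field_simps)
      qed
      ultimately show ?thesis
        unfolding if_not_P[OF False] by (rule Lim_transform_eventually)
    qed
  qed
  moreover have "(\<Sum>j\<le>N. (if j = M then 1 else 0) *\<^sub>R F j x) = (if N = M then F N x else 0)"
  proof -
    have "(\<Sum>j\<le>N. (if j = M then 1 else 0) *\<^sub>R F j x) = (\<Sum>j\<le>N. if j = M then F j x else 0)"
      by (intro sum.cong) auto
    then show ?thesis using \<open>N \<le> M\<close> by auto
  qed
  moreover have "(\<Sum>j\<le>N. F j (t *\<^sub>R x)) /\<^sub>R t ^ M = (\<Sum>j\<le>N. (t ^ j / t ^ M) *\<^sub>R F j x)" for t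
    using sum_homogeneous_scaleR[OF F, of N t x]
    by (simp add: scaleR_sum_right divide_inverse mult.commute)
  ultimately show ?thesis by simp
qed

section \<open>Degree and leading term of a polynomial map\<close>

lemma polynomial_map_degree_eqI:
  fixes F :: "nat \<Rightarrow> 'a::euclidean_space \<Rightarrow> 'b::euclidean_space"
  assumes F: "\<And>j. j \<le> N \<Longrightarrow> homogeneous_polynomial_map j (F j)"
    and f: "\<And>x. f x = (\<Sum>j\<le>N. F j x)" and top: "F N y \<noteq> 0"
  shows "polynomial_map_degree f = N"
proof -
  \<comment> \<open>If \<open>M' < M\<close>, then \<open>f (t *\<^sub>R z) /\<^sub>R t ^ M\<close>
    would tend to 0 by the shorter expansion and to \<open>G M z\<close> by the longer one. Applied
    in both directions, this gives uniqueness.\<close>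
  have le: "M \<le> M'"
    if "\<And>j. j \<le> M \<Longrightarrow> homogeneous_polynomial_map j (G j)" "\<And>x. f x = (\<Sum>j\<le>M. G j x)"
      "\<And>j. j \<le> M' \<Longrightarrow> homogeneous_polynomial_map j (G' j)" "\<And>x. f x = (\<Sum>j\<le>M'. G' j x)"
      "G M z \<noteq> 0"
    for M M' and G G' :: "nat \<Rightarrow> 'a \<Rightarrow> 'b" and z
  proof (rule ccontr)
    assume "\<not> M \<le> M'"
    then have "((\<lambda>t. f (t *\<^sub>R z) /\<^sub>R t ^ M) \<longlongrightarrow> 0) at_top"
      using tendsto_sum_homogeneous[of M' G' M z] that by simp
    moreover have "((\<lambda>t. f (t *\<^sub>R z) /\<^sub>R t ^ M) \<longlongrightarrow> G M z) at_top"
      using tendsto_sum_homogeneous[of M G M z] that by simp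
    ultimately have "G M z = 0"
      using tendsto_unique trivial_limit_at_top_linorder by blast
    with \<open>G M z \<noteq> 0\<close> show False by simp
  qed
  show ?thesis
    unfolding polynomial_map_degree_def
  proof (rule the_equality)
    show "\<exists>F. (\<forall>j\<le>N. homogeneous_polynomial_map j (F j)) \<and> (\<forall>x. f x = (\<Sum>j\<le>N. F j x)) \<and> (\<exists>x. F N x \<noteq> 0)"
      using assms by blast
  next
    fix M
    assume "\<exists>F. (\<forall>j\<le>M. homogeneous_polynomial_map j (F j)) \<and> (\<forall>x. f x = (\<Sum>j\<le>M. F j x)) \<and> (\<exists>x. F M x \<noteq> 0)"
    then obtain G z where "\<And>j. j \<le> M \<Longrightarrow> homogeneous_polynomial_map j (G j)"
      "\<And>x. f x = (\<Sum>j\<le>M. G j x)" "G M z \<noteq> 0" by blast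
    then show "M = N"
      using le[of M G N F z] le[of N F M G y] F f top by (simp add: antisym)
  qed
qed

text \<open>Top components that vanish identically are dropped. Since \<open>f\<close> is not
  constant, some component of positive degree is nonzero, hence \<open>0 < N\<close>.\<close>

lemma nonconstant_polynomial_leading_term:
  fixes f :: "'a::euclidean_space \<Rightarrow> 'b::euclidean_space"
  assumes "polynomial_function f" and nonconst: "\<not> f constant_on UNIV"
  obtains N F where "0 < N" "\<And>j. homogeneous_polynomial_map j (F j)"
    "\<And>x. f x = (\<Sum>j\<le>N. F j x)" "leading_term f = F N"
proof -
  obtain M F where F: "\<And>j. homogeneous_polynomial_map j (F j)" and f: "\<And>x. f x = (\<Sum>j\<le>M. F j x)"
    using polynomial_function_homogeneous_decomposition[OF assms(1)] by blast
  have hom: "F j (c *\<^sub>R x) = c ^ j *\<^sub>R F j x" for j c x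
    using F by (simp add: homogeneous_polynomial_map_def)
  \<comment> \<open>Homogeneity with \<open>c = 0\<close> and \<open>0 ^ 0 = 1\<close>.\<close>
  have const: "F 0 x = F 0 0" for x
    using hom[of 0 0 x] by simp
  define J where "J = {j. j \<le> M \<and> (\<exists>x. F j x \<noteq> 0)}"
  define N where "N = Max J"
  have "finite J" by (simp add: J_def)
  have "\<exists>j\<in>J. 0 < j"
  proof (rule ccontr)
    assume *: "\<not> ?thesis"
    have "f x = F 0 0" for x
    proof -
      have "f x = (\<Sum>j\<in>{0}. F j x)"
        unfolding f using * by (intro sum.mono_neutral_right) (auto simp: J_def)
      then show ?thesis using const[of x] by simp
    qed
    with nonconst show False by (auto simp: constant_on_def)
  qed
  then obtain j where "j \<in> J" "0 < j" by blast
  then have "N \<in> J" "0 < N"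
    using Max_in[OF \<open>finite J\<close>] Max_ge[OF \<open>finite J\<close> \<open>j \<in> J\<close>] by (auto simp: N_def)
  then obtain y where "F N y \<noteq> 0" "N \<le> M" by (auto simp: J_def)
  have fN: "f x = (\<Sum>j\<le>N. F j x)" for x
    unfolding f
  proof (rule sum.mono_neutral_right)
    show "\<forall>i\<in>{..M} - {..N}. F i x = 0"
    proof
      fix i assume "i \<in> {..M} - {..N}"
      then have "i \<notin> J"
        using Max_ge[OF \<open>finite J\<close>, of i] by (auto simp: N_def)
      with \<open>i \<in> {..M} - {..N}\<close> show "F i x = 0" by (simp add: J_def)
    qed
  qed (use \<open>N \<le> M\<close> in auto)
  have deg: "polynomial_map_degree f = N"
    using F fN \<open>F N y \<noteq> 0\<close> by (rule polynomial_map_degree_eqI)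
  have "leading_term f x = F N x" for x
  proof -
    have "((\<lambda>t. f (t *\<^sub>R x) /\<^sub>R t ^ N) \<longlongrightarrow> F N x) at_top"
      using tendsto_sum_homogeneous[of N F N x] F by (simp add: fN)
    then show ?thesis
      unfolding leading_term_def deg by (simp add: tendsto_Lim)
  qed
  with F fN \<open>0 < N\<close> show ?thesis by (intro that[of N F]) auto
qed

section \<open>Maps homotopic to the identity\<close>

text \<open>\<open>H\<close> leads from \<open>H 0\<close> to \<open>H 1\<close>, which is the
  identity only near 0. A second homotopy \<open>H 1 (s *\<^sub>R x) /\<^sub>R s\<close> lets
  \<open>s\<close> shrink until the scaled copy of \<open>\<Omega>\<close> lies in that
  neighbourhood. The property on \<open>k\<close> makes this a homotopy of maps of pairs into the
  space and its punctured part.\<close>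

lemma homotopic_with_id_nonzero:
  fixes H :: "real \<Rightarrow> 'a::euclidean_space \<Rightarrow> 'a"
  assumes cont: "continuous_on ({0..1} \<times> UNIV) (\<lambda>(t, x). H t x)"
    and nonzero: "\<And>t x. 0 \<le> t \<Longrightarrow> t \<le> 1 \<Longrightarrow> x \<noteq> 0 \<Longrightarrow> H t x \<noteq> 0"
    and near_0: "0 < e" "\<And>x. norm x < e \<Longrightarrow> H 1 x = x"
    and "bounded \<Omega>"
  shows "homotopic_with (\<lambda>k. k \<in> \<Omega> - {0} \<rightarrow> - {0}) (top_of_set \<Omega>) euclidean (H 0) id"
proof -
  let ?P = "\<lambda>k. k \<in> \<Omega> - {0} \<rightarrow> - {0::'a}"
  have "homotopic_with ?P (top_of_set \<Omega>) euclidean (H 0) (H 1)"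
    unfolding homotopic_with_def
    by (rule exI[of _ "\<lambda>(t, x). H t x"])
       (use nonzero in \<open>auto simp flip: subtopology_Times intro!: continuous_on_subset[OF cont]\<close>)
  moreover have "homotopic_with ?P (top_of_set \<Omega>) euclidean (H 1) id"
  proof -
    obtain B where "0 < B" and B: "\<And>x. x \<in> \<Omega> \<Longrightarrow> norm x \<le> B"
      using \<open>bounded \<Omega>\<close> bounded_pos by blast
    \<comment> \<open>On \<open>\<Omega>\<close> the norm of \<open>\<delta> *\<^sub>R x\<close> is
      at most \<open>e / 2\<close>. The function \<open>s\<close> below runs linearly from 1 to
      \<open>\<delta>\<close> and stays positive, so division by it is harmless.\<close>
    define \<delta> where "\<delta> = min 1 (e / (2 * B))"
    have \<delta>: "0 < \<delta>" "\<delta> \<le> 1" using \<open>0 < e\<close> \<open>0 < B\<close> by (auto simp: \<delta>_def)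
    define s where "s t = 1 - t + t * \<delta>" for t
    have s: "0 < s t" if "0 \<le> t" "t \<le> 1" for t
    proof (cases "t = 1")
      case False
      with that \<delta> show ?thesis by (simp add: s_def add_pos_nonneg)
    qed (simp add: s_def \<delta>)
    have small: "norm (\<delta> *\<^sub>R x) < e" if "x \<in> \<Omega>" for x
    proof -
      have "norm (\<delta> *\<^sub>R x) = \<delta> * norm x"
        using \<delta> by simp
      also have "\<dots> \<le> (e / (2 * B)) * B"
        using \<delta> \<open>0 < e\<close> \<open>0 < B\<close> by (intro mult_mono B that) (auto simp: \<delta>_def)
      also have "\<dots> < e" using \<open>0 < B\<close> \<open>0 < e\<close> by simp
      finally show ?thesis .
    qed
    have "continuous_on UNIV (\<lambda>x. case (1, x) of (t, x) \<Rightarrow> H t x)"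
      by (rule continuous_on_compose2[OF cont]) (auto intro!: continuous_intros)
    then have "continuous_on UNIV (H 1)" by simp
    note H1 = continuous_on_compose2[OF this _ subset_UNIV]
    have "continuous_on UNIV s"
      unfolding s_def by (intro continuous_intros)
    note s_cont = continuous_on_compose2[OF this _ subset_UNIV]
    have cs: "continuous_on ({0..1} \<times> \<Omega>) (\<lambda>(t, x). H 1 (s t *\<^sub>R x) /\<^sub>R s t)"
      unfolding case_prod_unfold
      by (intro continuous_intros H1 s_cont) (simp add: mem_Times_iff less_imp_neq[OF s, symmetric])
    have "homotopic_with ?P (top_of_set \<Omega>) euclidean
            (\<lambda>x. H 1 (s 0 *\<^sub>R x) /\<^sub>R s 0) (\<lambda>x. H 1 (s 1 *\<^sub>R x) /\<^sub>R s 1)"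
      unfolding homotopic_with_def
    proof (intro exI[of _ "\<lambda>(t, x). H 1 (s t *\<^sub>R x) /\<^sub>R s t"] conjI ballI)
      show "continuous_map (prod_topology (top_of_set {0..1}) (top_of_set \<Omega>)) euclidean
              (\<lambda>(t, x). H 1 (s t *\<^sub>R x) /\<^sub>R s t)"
        using cs by (simp flip: subtopology_Times)
      show "?P (\<lambda>x. case (t, x) of (t, x) \<Rightarrow> H 1 (s t *\<^sub>R x) /\<^sub>R s t)" if "t \<in> {0..1}" for t
        using that s[of t] nonzero[of 1] by auto
    qed auto
    then show ?thesis
    proof (rule homotopic_with_eq)
      show "id x = H 1 (s 1 *\<^sub>R x) /\<^sub>R s 1" if "x \<in> topspace (top_of_set \<Omega>)" for x
        using near_0(2)[OF small[of x]] that \<delta> by (simp add: s_def)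
      show "?P h \<longleftrightarrow> ?P k" if "\<And>x. x \<in> topspace (top_of_set \<Omega>) \<Longrightarrow> h x = k x" for h k
        using that by (auto simp: Pi_iff)
    qed (simp add: s_def)
  qed
  ultimately show ?thesis by (rule homotopic_with_trans)
qed

text \<open>A map without zeros on the contractible ball is null-homotopic on the sphere as a map
  into the punctured space. If it were also homotopic to the identity there, radial projection would
  contract the sphere within itself.\<close>

lemma not_homotopic_id_extends_nonzero:
  fixes g :: "'a::euclidean_space \<Rightarrow> 'a"
  assumes "continuous_on (cball 0 1) g" "\<And>x. x \<in> cball 0 1 \<Longrightarrow> g x \<noteq> 0"
  shows "\<not> homotopic_with_canon (\<lambda>_. True) (sphere 0 1) (- {0}) g id"
proof
  assume "homotopic_with_canon (\<lambda>_. True) (sphere 0 1) (- {0}) g id"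
  moreover obtain c where "homotopic_with_canon (\<lambda>_. True) (cball 0 1) (- {0}) g (\<lambda>x. c)"
    using nullhomotopic_from_contractible[of "cball 0 1" g "- {0}"] assms
    by (auto simp: convex_imp_contractible Pi_iff)
  then have "homotopic_with_canon (\<lambda>_. True) (sphere 0 1) (- {0}) g (\<lambda>x. c)"
    by (rule homotopic_with_subset_left) auto
  ultimately have "homotopic_with_canon (\<lambda>_. True) (sphere 0 1) (- {0}) id (\<lambda>x. c)"
    by (metis homotopic_with_symD homotopic_with_trans)
  then have "homotopic_with_canon (\<lambda>_. True) (sphere 0 1) (sphere 0 1)
               ((\<lambda>x. x /\<^sub>R norm x) \<circ> id) ((\<lambda>x. x /\<^sub>R norm x) \<circ> (\<lambda>x. c))"
    by (rule homotopic_with_compose_continuous_left) (auto intro!: continuous_intros)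
  then have "homotopic_with_canon (\<lambda>_. True) (sphere 0 1) (sphere 0 1) id (\<lambda>x::'a. c /\<^sub>R norm c)"
    by (rule homotopic_with_eq) auto
  then have "contractible (sphere (0::'a) 1)"
    unfolding contractible_def by blast
  then show False by (simp add: contractible_sphere)
qed

section \<open>Homology of the punctured space and maps of Brouwer degree 1\<close>

lemma reduced_homology_group_punctured:
  "reduced_homology_group (int DIM('a) - 1) (top_of_set (- {0::'a::euclidean_space})) \<cong> integer_group"
proof -
  obtain f :: "(nat \<Rightarrow> real) \<Rightarrow> 'a" and g
    where "homeomorphic_maps (nsphere (DIM('a) - 1)) (top_of_set (sphere 0 1 \<inter> span Basis)) f g"
    using homeomorphic_maps_nsphere_euclidean_sphere[of "Basis :: 'a set"]
    by (metis DIM_positive independent_Basis less_numeral_extra(3) norm_Basis orthogonal_Basis)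
  then have "nsphere (DIM('a) - 1) homeomorphic_space top_of_set (sphere (0::'a) 1)"
    by (auto simp: homeomorphic_space_def)
  moreover have "top_of_set (sphere (0::'a) 1) homotopy_equivalent_space top_of_set (- {0::'a})"
    using homotopy_eqv_rel_frontier_punctured_affine_hull[of "cball (0::'a) 1" 0]
    by (simp add: rel_frontier_cball affine_hull_nonempty_interior rel_interior_nonempty_interior
        Compl_eq_Diff_UNIV)
  ultimately have "nsphere (DIM('a) - 1) homotopy_equivalent_space top_of_set (- {0::'a})"
    using homeomorphic_imp_homotopy_equivalent_space homotopy_eqv_trans by blast
  then have "reduced_homology_group (int DIM('a) - 1) (nsphere (DIM('a) - 1)) \<cong>
             reduced_homology_group (int DIM('a) - 1) (top_of_set (- {0::'a}))"
    by (rule homotopy_equivalent_space_imp_isomorphic_reduced_homology_groups)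
  \<comment> \<open>Integer and truncated subtraction agree because the dimension is
    positive.\<close>
  moreover have "int DIM('a) - 1 = int (DIM('a) - 1)"
    by (simp add: DIM_positive of_nat_diff Suc_leI)
  ultimately show ?thesis
    by (metis group.iso_sym group_reduced_homology_group iso_trans reduced_homology_group_nsphere(1))
qed

text \<open>The whole space is contractible, so the boundary homomorphism identifies this group with
  the reduced homology of the punctured space one dimension lower.\<close>

lemma relative_homology_group_punctured:
  "relative_homology_group (int DIM('a)) euclidean (- {0::'a::euclidean_space}) \<cong> integer_group"
proof -
  have "(- {0::'a}) \<noteq> {}"
    by (metis ComplI UNIV_I norm_one norm_zero singletonD vector_choose_size zero_neq_one zero_le_one empty_iff)
  moreover have "contractible_space (euclidean :: 'a topology)"
    by (metis contractible_UNIV contractible_space_top_of_set subtopology_UNIV)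
  ultimately have "relative_homology_group (int DIM('a)) euclidean (- {0::'a}) \<cong>
      reduced_homology_group (int DIM('a) - 1) (top_of_set (- {0::'a}))"
    by (intro isomorphic_group_relative_homology_of_contractible) auto
  then show ?thesis
    using iso_trans reduced_homology_group_punctured by blast
qed

text \<open>Radial projection \<open>g\<close> onto the sphere of radius \<open>r\<close> is a
  homotopy inverse of the inclusion of the complement of the ball into the punctured space. Both
  homotopies are linear.\<close>

lemma homotopy_equivalence_punctured_inclusion:
  fixes r :: real
  assumes "0 < r"
  defines "g \<equiv> \<lambda>x::'a::euclidean_space. (r / norm x) *\<^sub>R x"
  shows "continuous_map (top_of_set (- {0})) (top_of_set (- ball 0 r)) g"
    and "homotopic_with (\<lambda>_. True) (top_of_set (- {0})) (top_of_set (- {0})) (id \<circ> g) id"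
    and "homotopic_with (\<lambda>_. True) (top_of_set (- ball 0 r)) (top_of_set (- ball 0 r)) (g \<circ> id) id"
proof -
  have cont: "continuous_on (- {0}) g"
    unfolding g_def by (auto intro!: continuous_intros)
  show "continuous_map (top_of_set (- {0})) (top_of_set (- ball 0 r)) g"
    using cont \<open>0 < r\<close> by (auto simp: g_def)
  \<comment> \<open>A point of the segment is a positive multiple of \<open>x\<close>, and its norm
    is a convex combination of \<open>r\<close> and \<open>norm x\<close>.\<close>
  have seg: "\<exists>c>0. y = c *\<^sub>R x \<and> (r \<le> norm x \<longrightarrow> r \<le> norm y)"
    if "x \<noteq> 0" and y: "y \<in> closed_segment (g x) x" for x y
  proof -
    obtain u where u: "0 \<le> u" "u \<le> 1" "y = (1 - u) *\<^sub>R g x + u *\<^sub>R x"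
      using y unfolding closed_segment_def by blast
    define c where "c = (1 - u) * (r / norm x) + u"
    have y: "y = c *\<^sub>R x" by (simp add: u c_def g_def algebra_simps)
    have "0 < c"
      using u \<open>x \<noteq> 0\<close> \<open>0 < r\<close> by (cases "u = 1") (auto simp: c_def intro!: add_pos_nonneg)
    moreover have "r \<le> norm y" if "r \<le> norm x"
    proof -
      have "norm y = (1 - u) * r + u * norm x"
        using \<open>0 < c\<close> \<open>x \<noteq> 0\<close> by (simp add: y c_def field_simps)
      also have "\<dots> \<ge> (1 - u) * r + u * r"
        using u that by (intro add_left_mono mult_left_mono)
      finally show ?thesis by (simp add: algebra_simps)
    qed
    ultimately show ?thesis using y by blast
  qed
  have "homotopic_with_canon (\<lambda>_. True) (- {0}) (- {0}) g id"
  proof (rule homotopic_with_linear)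
    show "closed_segment (g x) (id x) \<subseteq> - {0}" if "x \<in> - {0}" for x
    proof
      fix y assume "y \<in> closed_segment (g x) (id x)"
      with that show "y \<in> - {0}" using seg[of x y] by auto
    qed
  qed (simp_all add: cont continuous_on_id id_def)
  then show "homotopic_with (\<lambda>_. True) (top_of_set (- {0})) (top_of_set (- {0})) (id \<circ> g) id"
    by simp
  have "homotopic_with_canon (\<lambda>_. True) (- ball 0 r) (- ball 0 r) g id"
  proof (rule homotopic_with_linear)
    show "continuous_on (- ball 0 r) g"
      using \<open>0 < r\<close> by (intro continuous_on_subset[OF cont]) auto
    show "closed_segment (g x) (id x) \<subseteq> - ball 0 r" if "x \<in> - ball 0 r" for x
    proof
      fix y assume "y \<in> closed_segment (g x) (id x)"
      moreover have "x \<noteq> 0" "r \<le> norm x" using that \<open>0 < r\<close> by auto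
      ultimately show "y \<in> - ball 0 r" using seg[of x y] by auto
    qed
  qed (simp add: continuous_on_id id_def)
  then show "homotopic_with (\<lambda>_. True) (top_of_set (- ball 0 r)) (top_of_set (- ball 0 r)) (g \<circ> id) id"
    by simp
qed

lemma iso_preimage:
  assumes "h \<in> iso G H" "y \<in> carrier H"
  obtains x where "x \<in> carrier G" "h x = y"
proof -
  have "y \<in> h ` carrier G" using assms by (simp add: iso_iff)
  then show ?thesis using that by blast
qed

text \<open>In the naturality square of the boundary homomorphisms, both boundaries are isomorphisms
  because the space is contractible, and the inclusion of the subspaces induces an isomorphism
  because it is a homotopy equivalence. The preimage is found by a chase around the square.\<close>

lemma surj_hom_induced_punctured:
  fixes r :: real
  assumes "0 < r" and a: "a \<in> carrier (relative_homology_group p euclidean (- {0::'a::euclidean_space}))"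
  shows "\<exists>b \<in> carrier (relative_homology_group p euclidean (- ball (0::'a) r)).
           hom_induced p euclidean (- ball 0 r) euclidean (- {0}) id b = a"
proof -
  let ?E = "euclidean :: 'a topology"
  obtain v :: 'a where v: "norm v = r" using vector_choose_size[of r] \<open>0 < r\<close> by auto
  have contractible: "contractible_space ?E"
    by (metis contractible_UNIV contractible_space_top_of_set subtopology_UNIV)
  have iso0: "hom_boundary p ?E (- {0}) \<in>
      iso (relative_homology_group p ?E (- {0})) (reduced_homology_group (p - 1) (top_of_set (- {0})))"
    by (rule iso_relative_homology_of_contractible[OF contractible]) (use v \<open>0 < r\<close> in auto)
  have iso1: "hom_boundary p ?E (- ball 0 r) \<in>
      iso (relative_homology_group p ?E (- ball 0 r)) (reduced_homology_group (p - 1) (top_of_set (- ball 0 r)))"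
    by (rule iso_relative_homology_of_contractible[OF contractible]) (use v \<open>0 < r\<close> in auto)
  have iso2: "hom_induced (p - 1) (top_of_set (- ball 0 r)) {} (top_of_set (- {0::'a})) {} id \<in>
      iso (reduced_homology_group (p - 1) (top_of_set (- ball 0 r))) (reduced_homology_group (p - 1) (top_of_set (- {0})))"
    by (rule homotopy_equivalence_reduced_homology_group_isomorphism
          [OF _ homotopy_equivalence_punctured_inclusion(1)[OF \<open>0 < r\<close>]
              homotopy_equivalence_punctured_inclusion(3)[OF \<open>0 < r\<close>]
              homotopy_equivalence_punctured_inclusion(2)[OF \<open>0 < r\<close>]])
       (use \<open>0 < r\<close> in auto)
  have "hom_boundary p ?E (- {0}) a \<in> carrier (reduced_homology_group (p - 1) (top_of_set (- {0})))"
    using iso0 a by (auto simp: iso_def hom_def)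
  then obtain b' where b': "b' \<in> carrier (reduced_homology_group (p - 1) (top_of_set (- ball 0 r)))"
    "hom_induced (p - 1) (top_of_set (- ball 0 r)) {} (top_of_set (- {0})) {} id b' = hom_boundary p ?E (- {0}) a"
    by (rule iso_preimage[OF iso2])
  obtain b where b: "b \<in> carrier (relative_homology_group p ?E (- ball 0 r))"
    "hom_boundary p ?E (- ball 0 r) b = b'"
    by (rule iso_preimage[OF iso1 b'(1)])
  let ?i = "hom_induced p ?E (- ball 0 r) ?E (- {0}) id"
  have "hom_boundary p ?E (- {0}) (?i b) = hom_boundary p ?E (- {0}) a"
  proof -
    have "id \<in> - ball 0 r \<rightarrow> - {0::'a}" using \<open>0 < r\<close> by auto
    from fun_cong[OF naturality_hom_induced[of ?E ?E id "- ball 0 r" "- {0}" p, OF continuous_map_id this], of b]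
    show ?thesis
      by (simp add: b(2) b'(2))
  qed
  then have "?i b = a"
    using iso0 a hom_induced_carrier[of p ?E _ ?E "- {0}" id b] by (auto simp: iso_def bij_betw_def inj_on_def)
  with b show ?thesis by blast
qed

text \<open>Excision of the complement of \<open>\<Omega>\<close>, which is closed and lies in the
  open set \<open>- {0}\<close>.\<close>

lemma surj_hom_induced_open_punctured:
  fixes \<Omega> :: "'a::euclidean_space set"
  assumes "open \<Omega>" "0 \<in> \<Omega>" and a: "a \<in> carrier (relative_homology_group p euclidean (- {0}))"
  shows "\<exists>c \<in> carrier (relative_homology_group p (top_of_set \<Omega>) (\<Omega> - {0})).
           hom_induced p (top_of_set \<Omega>) (\<Omega> - {0}) euclidean (- {0}) id c = a"
proof -
  have "hom_induced p (subtopology euclidean (UNIV - - \<Omega>)) (- {0} - - \<Omega>) (subtopology euclidean UNIV) (- {0}) id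
    \<in> iso (relative_homology_group p (subtopology euclidean (UNIV - - \<Omega>)) (- {0} - - \<Omega>))
          (relative_homology_group p (subtopology euclidean UNIV) (- {0}))"
  proof (rule homology_excision_axiom)
    show "euclidean closure_of - \<Omega> \<subseteq> euclidean interior_of - {0}"
      using \<open>open \<Omega>\<close> \<open>0 \<in> \<Omega>\<close> by (simp add: closure_closed interior_open closed_Compl open_Compl)
  qed simp
  moreover have "UNIV - - \<Omega> = \<Omega>" "- {0} - - \<Omega> = \<Omega> - {0}" by auto
  ultimately have "hom_induced p (top_of_set \<Omega>) (\<Omega> - {0}) euclidean (- {0}) id
    \<in> iso (relative_homology_group p (top_of_set \<Omega>) (\<Omega> - {0})) (relative_homology_group p euclidean (- {0}))"
    by simp
  from iso_preimage[OF this a] show ?thesis by blast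
qed

text \<open>By the homotopy axiom \<open>h\<close> and \<open>id\<close> induce the same
  homomorphism, so for \<open>k = 1\<close> the condition repeats its premise. Uniqueness of
  \<open>k\<close> needs a class of infinite order that comes both from \<open>\<Omega>\<close> and
  from the complement of a ball.\<close>

lemma brouwer_degree_eq_1:
  fixes h :: "'a::euclidean_space \<Rightarrow> 'a"
  assumes \<Omega>: "open \<Omega>" "bounded \<Omega>" "0 \<in> \<Omega>" and zero: "\<And>x. x \<in> \<Omega> \<Longrightarrow> h x = 0 \<longleftrightarrow> x = 0"
    and hom: "homotopic_with (\<lambda>k. k \<in> \<Omega> - {0} \<rightarrow> - {0}) (top_of_set \<Omega>) euclidean h id"
  shows "brouwer_degree h \<Omega> 0 = 1"
proof -
  let ?n = "int DIM('a)"
  let ?H = "relative_homology_group ?n euclidean (- {0::'a})"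
  interpret H: group ?H by simp
  have K: "{x \<in> \<Omega>. h x = 0} = {0}" using zero \<open>0 \<in> \<Omega>\<close> by auto
  have h_id: "hom_induced ?n (top_of_set \<Omega>) (\<Omega> - {0}) euclidean (- {0}) h =
        hom_induced ?n (top_of_set \<Omega>) (\<Omega> - {0}) euclidean (- {0}) id"
    by (rule homology_homotopy_axiom[OF hom])
  show ?thesis
    unfolding brouwer_degree_def Let_def K h_id
  proof (rule the_equality)
    fix k :: int
    assume *: "\<forall>r. \<Omega> \<union> {0} \<subseteq> ball 0 r \<longrightarrow>
           (\<forall>o\<^sub>B \<in> carrier (relative_homology_group ?n euclidean (- ball 0 r)).
            \<forall>c \<in> carrier (relative_homology_group ?n (top_of_set \<Omega>) (\<Omega> - {0})).
              hom_induced ?n (top_of_set \<Omega>) (\<Omega> - {0}) euclidean (- {0}) id c =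
              hom_induced ?n euclidean (- ball 0 r) euclidean (- {0}) id o\<^sub>B \<longrightarrow>
              hom_induced ?n (top_of_set \<Omega>) (\<Omega> - {0}) euclidean (- {0}) id c =
              hom_induced ?n euclidean (- ball 0 r) euclidean (- {0}) id o\<^sub>B [^]\<^bsub>?H\<^esub> k)"
    obtain \<phi> where \<phi>: "\<phi> \<in> iso ?H integer_group"
      using relative_homology_group_punctured[where 'a='a] by (auto simp: is_iso_def)
    then have hom\<phi>: "\<phi> \<in> hom ?H integer_group" by (simp add: iso_iff)
    \<comment> \<open>The class \<open>a\<close> corresponds to the integer 1, so
      \<open>a = a [^] k\<close> becomes \<open>1 = k\<close>.\<close>
    obtain a where a: "a \<in> carrier ?H" "\<phi> a = 1"
      by (rule iso_preimage[OF \<phi>, of 1]) auto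
    obtain r where r: "0 < r" "\<Omega> \<subseteq> ball 0 r"
      using bounded_subset_ballD[OF \<open>bounded \<Omega>\<close>, of 0] by auto
    obtain b where "b \<in> carrier (relative_homology_group ?n euclidean (- ball (0::'a) r))"
        "hom_induced ?n euclidean (- ball 0 r) euclidean (- {0}) id b = a"
      using surj_hom_induced_punctured[OF \<open>0 < r\<close> a(1)] by blast
    moreover obtain c where "c \<in> carrier (relative_homology_group ?n (top_of_set \<Omega>) (\<Omega> - {0}))"
        "hom_induced ?n (top_of_set \<Omega>) (\<Omega> - {0}) euclidean (- {0}) id c = a"
      using surj_hom_induced_open_punctured[OF \<Omega>(1,3) a(1)] by blast
    ultimately have "a = a [^]\<^bsub>?H\<^esub> k"
      using * r by auto
    then have "\<phi> a = \<phi> a [^]\<^bsub>integer_group\<^esub> k"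
      using hom_int_pow[OF hom\<phi> a(1) H.is_group group_integer_group, of k] by metis
    then show "k = 1" using a by simp
  qed (simp add: hom_induced_carrier)
qed

section \<open>The scaled complementarity problem\<close>

text \<open>Outside 0 the condition on pairs says that the homotopy avoids 0, so its codomain can be
  restricted. This passes from the degree setting to the unit sphere.\<close>

lemma homotopic_with_nonzero_canon:
  fixes f g :: "'a::euclidean_space \<Rightarrow> 'b::euclidean_space"
  assumes "homotopic_with (\<lambda>k. k \<in> S - {0} \<rightarrow> - {0}) (top_of_set S) euclidean f g" "0 \<notin> S"
  shows "homotopic_with_canon (\<lambda>_. True) S (- {0}) f g"
proof -
  obtain h where h: "continuous_map (prod_topology (top_of_set {0..1::real}) (top_of_set S)) euclidean h"
    "\<forall>x. h (0, x) = f x" "\<forall>x. h (1, x) = g x" "\<forall>t\<in>{0..1}. (\<lambda>x. h (t, x)) \<in> S - {0} \<rightarrow> - {0}"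
    using assms(1) unfolding homotopic_with_def by blast
  have "h \<in> {0..1} \<times> S \<rightarrow> - {0}"
    using h(4) \<open>0 \<notin> S\<close> by (auto simp: Pi_iff)
  with h show ?thesis
    unfolding homotopic_with_def by (intro exI[of _ h]) (auto simp: continuous_map_in_subtopology Pi_iff)
qed

text \<open>Two reals have minimum 0 exactly if both are nonnegative and their product is 0; a sum
  of nonnegative products vanishes only if each product does.\<close>

lemma min_vec_eq_0_iff:
  fixes x y :: "real^'n"
  shows "(\<chi> i. min (x $ i) (y $ i)) = 0 \<longleftrightarrow> (\<forall>i. 0 \<le> x $ i) \<and> (\<forall>i. 0 \<le> y $ i) \<and> x \<bullet> y = 0"
proof
  assume "(\<chi> i. min (x $ i) (y $ i)) = 0"
  then have "min (x $ i) (y $ i) = 0" for i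
    by (simp add: vec_eq_iff)
  then have *: "0 \<le> x $ i \<and> 0 \<le> y $ i \<and> x $ i * y $ i = 0" for i
    by (smt (verit) mult_eq_0_iff)
  then show "(\<forall>i. 0 \<le> x $ i) \<and> (\<forall>i. 0 \<le> y $ i) \<and> x \<bullet> y = 0"
    by (auto simp: inner_vec_def intro!: sum.neutral)
next
  assume *: "(\<forall>i. 0 \<le> x $ i) \<and> (\<forall>i. 0 \<le> y $ i) \<and> x \<bullet> y = 0"
  then have "(\<Sum>i\<in>UNIV. x $ i * y $ i) = 0"
    by (simp add: inner_vec_def)
  then have "x $ i * y $ i = 0" for i
    using * by (simp add: sum_nonneg_eq_0_iff)
  with * show "(\<chi> i. min (x $ i) (y $ i)) = 0"
    by (auto simp: vec_eq_iff min_def) (metis order_antisym)+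
qed

lemma min_map_eq_0_iff: "min_map g x = 0 \<longleftrightarrow> x \<in> SOL g 0"
  unfolding min_map_def min_vec_eq_0_iff by (simp add: SOL_def)

text \<open>
  For \<open>t > 0\<close> the second argument of the minimum is \<open>t\<^sup>N (f (x / t) + q)\<close>; clearing denominators
  extends it continuously to \<open>t = 0\<close>, where only the leading term survives.
\<close>

definition pcp_homotopy ::
    "(nat \<Rightarrow> real^'n \<Rightarrow> real^'n) \<Rightarrow> nat \<Rightarrow> real^'n \<Rightarrow> real \<Rightarrow> real^'n \<Rightarrow> real^'n" where
  "pcp_homotopy F N q t x =
     (\<chi> i. min (x $ i) (((\<Sum>j\<le>N. t ^ (N - j) *\<^sub>R F j x) + t ^ N *\<^sub>R q) $ i))"

text \<open>Interpreted twice below: for \<open>f\<close>, and for \<open>F N\<close> regarded as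
  its own expansion. Thus conditions (b) and (a) are covered by one argument.\<close>

locale homogeneous_expansion =
  fixes f :: "real^'n \<Rightarrow> real^'n" and F :: "nat \<Rightarrow> real^'n \<Rightarrow> real^'n" and N :: nat
  assumes homogeneous: "homogeneous_polynomial_map j (F j)"
    and expansion: "f x = (\<Sum>j\<le>N. F j x)"
    and degree_pos: "0 < N"
begin

lemma continuous_on_component_map: "continuous_on S (F j)"
  using homogeneous[of j] by (simp add: homogeneous_polynomial_map_def continuous_on_polymonial_function)

lemma continuous_on_pcp_homotopy: "continuous_on S (\<lambda>(t, x). pcp_homotopy F N q t x)"
  unfolding pcp_homotopy_def case_prod_unfold
  by (intro continuous_intros continuous_on_compose2[OF continuous_on_component_map[of UNIV]]) auto

lemma pcp_homotopy_0: "pcp_homotopy F N q 0 = min_map (F N)"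
proof
  fix x
  \<comment> \<open>The factor is \<open>0 ^ 0 = 1\<close> for \<open>j = N\<close> and 0 otherwise;
    \<open>0 < N\<close> also removes the term with \<open>q\<close>.\<close>
  have "(\<Sum>j\<le>N. 0 ^ (N - j) *\<^sub>R F j x) = (\<Sum>j\<in>{N}. 0 ^ (N - j) *\<^sub>R F j x)"
    by (intro sum.mono_neutral_right) auto
  then show "pcp_homotopy F N q 0 x = min_map (F N) x"
    using degree_pos by (simp add: pcp_homotopy_def min_map_def power_0_left)
qed

text \<open>By homogeneity the two arguments of the minimum become \<open>t *\<^sub>R u\<close> and
  \<open>t ^ N *\<^sub>R (f u + q)\<close>; positive factors do not affect complementarity.\<close>

lemma pcp_homotopy_eq_0_iff:
  assumes "0 < t"
  shows "pcp_homotopy F N q t (t *\<^sub>R u) = 0 \<longleftrightarrow> u \<in> SOL f q"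
proof -
  have "(\<Sum>j\<le>N. t ^ (N - j) *\<^sub>R F j (t *\<^sub>R u)) = (\<Sum>j\<le>N. t ^ N *\<^sub>R F j u)"
    using homogeneous
    by (intro sum.cong) (auto simp: homogeneous_polynomial_map_def simp flip: power_add)
  also have "\<dots> = t ^ N *\<^sub>R f u"
    by (simp add: expansion scaleR_sum_right)
  finally have "(\<Sum>j\<le>N. t ^ (N - j) *\<^sub>R F j (t *\<^sub>R u)) + t ^ N *\<^sub>R q = t ^ N *\<^sub>R (f u + q)"
    by (simp add: scaleR_add_right)
  moreover have "0 < t ^ N" using \<open>0 < t\<close> by simp
  ultimately show ?thesis
    unfolding pcp_homotopy_def min_vec_eq_0_iff SOL_def mem_Collect_eq
    using \<open>0 < t\<close> by (simp add: zero_le_mult_iff power_le_zero_eq)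
qed

lemma pcp_homotopy_eq_0_iff':
  assumes "0 < t"
  shows "pcp_homotopy F N q t x = 0 \<longleftrightarrow> x /\<^sub>R t \<in> SOL f q"
  using pcp_homotopy_eq_0_iff[OF assms, of q "x /\<^sub>R t"] assms by simp

text \<open>\<open>SOL_0\<close> excludes nontrivial zeros of \<open>pcp_homotopy F N d t\<close> at
  \<open>t = 0\<close>, and \<open>SOL_d\<close> excludes them at every \<open>t > 0\<close> by
  scaling.\<close>

lemma homotopic_min_map_leading_id:
  assumes "f 0 = 0" and d: "\<And>i. 0 < d $ i"
    and SOL_0: "SOL (F N) 0 = {0}" and SOL_d: "SOL f d = {0}" and "bounded \<Omega>"
  shows "homotopic_with (\<lambda>k. k \<in> \<Omega> - {0} \<rightarrow> - {0}) (top_of_set \<Omega>) euclidean (min_map (F N)) id"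
proof -
  define m where "m = Min (range (($) d))"
  have m: "0 < m" "\<And>i. m \<le> d $ i"
    using d by (auto simp: m_def)
  have "continuous_on UNIV f"
    unfolding expansion by (intro continuous_intros continuous_on_component_map)
  then have "isCont f 0" by (simp add: continuous_on_eq_continuous_at)
  then obtain e where "0 < e" and e: "\<And>x. norm x < e \<Longrightarrow> norm (f x) < m / 2"
    using \<open>0 < m\<close> \<open>f 0 = 0\<close> unfolding continuous_at_eps_delta
    by (metis dist_norm diff_zero half_gt_zero)
  have "pcp_homotopy F N d 1 x = x" if "norm x < min e (m / 2)" for x
  proof -
    \<comment> \<open>Here \<open>f x $ i > - m / 2\<close> and \<open>d $ i \<ge> m\<close>, so the
      right side exceeds \<open>m / 2\<close>, which exceeds \<open>x $ i\<close>. The minimum is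
      therefore \<open>x $ i\<close>.\<close>
    have "x $ i \<le> f x $ i + d $ i" for i
      using e[of x] that m(2)[of i] component_le_norm_cart[of x i] component_le_norm_cart[of "f x" i]
      by auto
    then show ?thesis
      by (simp add: pcp_homotopy_def vec_eq_iff flip: expansion)
  qed
  moreover have "pcp_homotopy F N d t x \<noteq> 0" if "0 \<le> t" "x \<noteq> 0" for t x
  proof (cases "t = 0")
    case True
    with SOL_0 \<open>x \<noteq> 0\<close> show ?thesis by (simp add: pcp_homotopy_0 min_map_eq_0_iff)
  next
    case False
    with that SOL_d show ?thesis by (simp add: pcp_homotopy_eq_0_iff')
  qed
  ultimately have "homotopic_with (\<lambda>k. k \<in> \<Omega> - {0} \<rightarrow> - {0}) (top_of_set \<Omega>) euclidean (pcp_homotopy F N d 0) id"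
    using \<open>0 < e\<close> \<open>0 < m\<close> \<open>bounded \<Omega>\<close>
    by (intro homotopic_with_id_nonzero[OF continuous_on_pcp_homotopy, where e = "min e (m / 2)"]) auto
  then show ?thesis by (simp add: pcp_homotopy_0)
qed

section \<open>Boundedness and existence of solutions\<close>

lemma pcp_homotopy_nonzero_on_sphere:
  assumes SOL_0: "SOL (F N) 0 = {0}"
  obtains \<tau> where "0 < \<tau>" "\<And>t x. 0 \<le> t \<Longrightarrow> t \<le> \<tau> \<Longrightarrow> norm x = 1 \<Longrightarrow> pcp_homotopy F N q t x \<noteq> 0"
proof -
  \<comment> \<open>The zeros over the unit sphere form a compact set. Its projection to the
    parameter is closed and misses 0 by \<open>SOL_0\<close>, hence misses a neighbourhood of
    0.\<close>
  define K where "K = {p \<in> {0..1} \<times> sphere 0 1. (case p of (t, x) \<Rightarrow> pcp_homotopy F N q t x) = 0}"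
  have "compact K"
  proof -
    have "closedin (top_of_set ({0..1} \<times> sphere 0 1)) K"
      unfolding K_def by (intro continuous_closedin_preimage_constant continuous_on_pcp_homotopy)
    then show ?thesis
      by (rule closedin_compact[rotated]) (intro compact_Times compact_Icc compact_sphere)
  qed
  then have "closed (fst ` K)"
    by (intro compact_imp_closed compact_continuous_image continuous_intros)
  moreover have "0 \<notin> fst ` K"
    using SOL_0 by (force simp: K_def pcp_homotopy_0 min_map_eq_0_iff)
  ultimately obtain e where "0 < e" and e: "ball 0 e \<subseteq> - fst ` K"
    by (metis ComplI open_Compl open_contains_ball)
  \<comment> \<open>The bound 1 keeps \<open>t\<close> in the range covered by \<open>K\<close>, and
    \<open>e / 2\<close> keeps it in the open ball.\<close>
  show ?thesis
  proof (rule that[of "min 1 (e / 2)"])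
    fix t and x :: "real^'n"
    assume "0 \<le> t" "t \<le> min 1 (e / 2)" "norm x = 1"
    then have "t \<in> ball 0 e" "t \<in> {0..1}" using \<open>0 < e\<close> by auto
    with e have "(t, x) \<notin> K" by force
    with \<open>t \<in> {0..1}\<close> \<open>norm x = 1\<close> show "pcp_homotopy F N q t x \<noteq> 0"
      by (simp add: K_def)
  qed (use \<open>0 < e\<close> in simp)
qed

text \<open>A solution \<open>u\<close> of norm above \<open>1 / \<tau>\<close> would give a zero on
  the unit sphere, namely \<open>u\<close> normalized, at the parameter
  \<open>1 / norm u < \<tau>\<close>. Closedness holds because \<open>SOL f q\<close> is the zero
  set at \<open>t = 1\<close>.\<close>

lemma compact_SOL:
  assumes "SOL (F N) 0 = {0}"
  shows "compact (SOL f q)"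
proof -
  obtain \<tau> where "0 < \<tau>"
    and \<tau>: "\<And>t x. 0 \<le> t \<Longrightarrow> t \<le> \<tau> \<Longrightarrow> norm x = 1 \<Longrightarrow> pcp_homotopy F N q t x \<noteq> 0"
    using pcp_homotopy_nonzero_on_sphere[OF assms] by metis
  have "norm u \<le> 1 / \<tau>" if "u \<in> SOL f q" for u
  proof (rule ccontr)
    assume *: "\<not> norm u \<le> 1 / \<tau>"
    moreover have "0 < 1 / \<tau>" using \<open>0 < \<tau>\<close> by simp
    ultimately have "0 < norm u" by linarith
    with * \<open>0 < \<tau>\<close> have "1 / norm u \<le> \<tau>"
      by (simp add: field_simps)
    then have "pcp_homotopy F N q (1 / norm u) ((1 / norm u) *\<^sub>R u) \<noteq> 0"
      using \<open>0 < norm u\<close> by (intro \<tau>) auto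
    with that \<open>0 < norm u\<close> show False
      by (subst (asm) pcp_homotopy_eq_0_iff) auto
  qed
  then have "bounded (SOL f q)"
    by (auto simp: bounded_iff)
  moreover have "closed (SOL f q)"
  proof -
    have "SOL f q = {u. pcp_homotopy F N q 1 u = 0}"
      using pcp_homotopy_eq_0_iff[of 1 q] by auto
    moreover have "continuous_on UNIV (\<lambda>x. case (1, x) of (t, x) \<Rightarrow> pcp_homotopy F N q t x)"
      by (rule continuous_on_compose2[OF continuous_on_pcp_homotopy[of UNIV]]) (auto intro!: continuous_intros)
    ultimately show ?thesis
      by (simp add: closed_Collect_eq)
  qed
  ultimately show ?thesis by (simp add: compact_eq_bounded_closed)
qed

lemma SOL_nonempty:
  assumes "SOL (F N) 0 = {0}"
    and id: "homotopic_with_canon (\<lambda>_. True) (sphere 0 1) (- {0}) (min_map (F N)) id"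
  shows "SOL f q \<noteq> {}"
proof
  assume empty: "SOL f q = {}"
  obtain \<tau> where "0 < \<tau>"
    and \<tau>: "\<And>t x. 0 \<le> t \<Longrightarrow> t \<le> \<tau> \<Longrightarrow> norm x = 1 \<Longrightarrow> pcp_homotopy F N q t x \<noteq> 0"
    using pcp_homotopy_nonzero_on_sphere[OF assms(1)] by metis
  \<comment> \<open>The parameter interval from 0 to \<open>\<tau>\<close> is rescaled to the unit
    interval required of homotopies.\<close>
  let ?H = "\<lambda>(s, x). pcp_homotopy F N q (s * \<tau>) x"
  have cont: "continuous_on S ?H" for S
  proof -
    have "continuous_on S (\<lambda>p. case (fst p * \<tau>, snd p) of (t, x) \<Rightarrow> pcp_homotopy F N q t x)"
      by (rule continuous_on_compose2[OF continuous_on_pcp_homotopy[of UNIV]]) (auto intro!: continuous_intros)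
    then show ?thesis by (simp add: case_prod_unfold)
  qed
  have "homotopic_with_canon (\<lambda>_. True) (sphere 0 1) (- {0}) (min_map (F N)) (pcp_homotopy F N q \<tau>)"
    unfolding homotopic_with_def
  proof (intro exI[of _ ?H] conjI allI)
    have "?H \<in> {0..1} \<times> sphere 0 1 \<rightarrow> - {0}"
      using \<tau> \<open>0 < \<tau>\<close> by (auto simp: mult_left_le_one_le)
    then show "continuous_map (prod_topology (top_of_set {0..1}) (top_of_set (sphere 0 1))) (top_of_set (- {0})) ?H"
      using cont by (auto simp flip: subtopology_Times)
  qed (auto simp: pcp_homotopy_0)
  from homotopic_with_trans[OF homotopic_with_symD[OF this] id]
  have "homotopic_with_canon (\<lambda>_. True) (sphere 0 1) (- {0}) (pcp_homotopy F N q \<tau>) id" .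
  moreover have "continuous_on (cball 0 1) (pcp_homotopy F N q \<tau>)"
  proof -
    have "continuous_on (cball 0 1) (\<lambda>x. case (\<tau>, x) of (t, x) \<Rightarrow> pcp_homotopy F N q t x)"
      by (rule continuous_on_compose2[OF continuous_on_pcp_homotopy[of UNIV]]) (auto intro!: continuous_intros)
    then show ?thesis by simp
  qed
  \<comment> \<open>A zero \<open>x\<close> would make \<open>x /\<^sub>R \<tau>\<close> a
    solution.\<close>
  moreover have "pcp_homotopy F N q \<tau> x \<noteq> 0" for x
    using empty pcp_homotopy_eq_0_iff'[OF \<open>0 < \<tau>\<close>] by simp
  ultimately show False
    using not_homotopic_id_extends_nonzero by blast
qed

end

text \<open>All lower components are replaced by 0, which is homogeneous of every degree; the top
  component, and with it the map at \<open>t = 0\<close>, stays the same.\<close>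

lemma homogeneous_expansion_leading:
  assumes "homogeneous_expansion f F N"
  shows "homogeneous_expansion (F N) (\<lambda>j x. if j = N then F N x else 0) N"
proof -
  interpret homogeneous_expansion f F N by fact
  show ?thesis
  proof
    show "homogeneous_polynomial_map j (\<lambda>x. if j = N then F N x else 0)" for j
      using homogeneous[of N] by (cases "j = N") (auto simp: homogeneous_polynomial_map_def)
  qed (use degree_pos in auto)
qed

theorem theorem5p1:
  fixes f :: "real^'n \<Rightarrow> real^'n" and d :: "real^'n"
  assumes "polynomial_function f"
    and "\<not> f constant_on UNIV"
    and "f 0 = 0"
    and "\<forall>i. 0 < d $ i"
    and "(SOL (leading_term f) 0 = {0} \<and> SOL (leading_term f) d = {0}) \<or>
         (SOL (leading_term f) 0 = {0} \<and> SOL f d = {0})"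
  shows "(\<forall>\<Omega>. open \<Omega> \<and> bounded \<Omega> \<and> 0 \<in> \<Omega> \<longrightarrow>
            brouwer_degree (min_map (leading_term f)) \<Omega> 0 = 1) \<and>
         (\<forall>q. SOL f q \<noteq> {} \<and> compact (SOL f q))"
proof -
  obtain N F where N: "0 < N" and F: "\<And>j. homogeneous_polynomial_map j (F j)"
    and f: "\<And>x. f x = (\<Sum>j\<le>N. F j x)" and lead: "leading_term f = F N"
    using nonconstant_polynomial_leading_term[OF assms(1,2)] by metis
  interpret homogeneous_expansion f F N
    by standard (use N F f in auto)
  interpret leading: homogeneous_expansion "F N" "\<lambda>j x. if j = N then F N x else 0" N
    by (rule homogeneous_expansion_leading) (rule homogeneous_expansion_axioms)
  have SOL_0: "SOL (F N) 0 = {0}" using assms(5) by (auto simp: lead)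
  \<comment> \<open>Positive degree forces the value 0 at the origin, which plays the part of
    \<open>f 0 = 0\<close> in case (a).\<close>
  have "F N (0 *\<^sub>R 0) = 0 ^ N *\<^sub>R F N 0"
    using F[of N] by (simp only: homogeneous_polynomial_map_def)
  then have "F N 0 = 0" using N by (simp add: power_0_left)
  have id: "homotopic_with (\<lambda>k. k \<in> \<Omega> - {0} \<rightarrow> - {0}) (top_of_set \<Omega>) euclidean (min_map (F N)) id"
    if "bounded \<Omega>" for \<Omega>
    using assms(5)
  proof
    assume "SOL (leading_term f) 0 = {0} \<and> SOL (leading_term f) d = {0}"
    then show ?thesis
      using leading.homotopic_min_map_leading_id[of d \<Omega>] \<open>F N 0 = 0\<close> assms(4) that by (simp add: lead)
  next
    assume "SOL (leading_term f) 0 = {0} \<and> SOL f d = {0}"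
    then show ?thesis
      using homotopic_min_map_leading_id[of d \<Omega>] assms(3,4) that by (simp add: lead)
  qed
  have "brouwer_degree (min_map (F N)) \<Omega> 0 = 1" if "open \<Omega>" "bounded \<Omega>" "0 \<in> \<Omega>" for \<Omega>
    using that SOL_0 by (intro brouwer_degree_eq_1 id) (auto simp: min_map_eq_0_iff)
  \<comment> \<open>The homotopy \<open>id\<close> is used here on the unit sphere, a bounded set
    that does not contain 0.\<close>
  moreover have "SOL f q \<noteq> {}" for q
    by (intro SOL_nonempty SOL_0 homotopic_with_nonzero_canon id) auto
  ultimately show ?thesis
    using compact_SOL[OF SOL_0] by (simp add: lead)
qed

end
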